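(* Consider the planar $n$-vortex problem with a fixed choice of circulations $\Gamma_1,\dots,\Gamma_n$ satisfying $\Gamma_i>0$ for all $i$. Let ${\cal N}=\{z\in\mathbb{R}^{2n}: c=0,\ I(z)=1\}$ be the normalized configuration space and $\Delta=\{z\in\mathbb{R}^{2n}: z_i=z_j\text{ for some }i\neq j\}$ the collision set. Then there is a neighborhood of $\Delta$ in ${\cal N}$ (i.e. an open subset of ${\cal N}$ containing $\Delta\cap{\cal N}$) which contains no relative equilibria.
   Context: Planar $n$-vortex problem: vortices at positions $z_i\in\mathbb{R}^2$ with circulations $\Gamma_i$; $z=(z_1,\dots,z_n)\in\mathbb{R}^{2n}$, $r_{ij}=\|z_i-z_j\|$, $\Gamma=\sum_i\Gamma_i\neq0$. Center of vorticity $c=\frac1\Gamma\sum_i\Gamma_iz_i$; angular impulse $I(z)=\sum_i\Gamma_i\|z_i-c\|^2$. A relative equilibrium is a configuration $z\in\mathbb{R}^{2n}\setminus\Delta$ satisfying, for some real $\omega\neq0$, $\sum_{j\ne i}\frac{\Gamma_i\Gamma_j}{r_{ij}^2}(z_j-z_i)+\omega\Gamma_i(z_i-c)=0$ for all $i\in\{1,\dots,n\}$. Equivalently, $\nabla H(z)+\frac{\omega}{2}\nabla I(z)=0$ where $H(z)=-\sum_{i<j}\Gamma_i\Gamma_j\ln r_{ij}$. *)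

theory Defs
  imports "HOL-Analysis.Analysis"
begin

text \<open>
  A configuration of the vortices indexed by the finite type \<open>'n\<close> (so \<open>n = CARD('n)\<close>, which is
  arbitrary and positive) is a point of \<open>real ^ 2 ^ 'n\<close>, whose standard topology is that of
  \<open>R\<close> to the power \<open>2 n\<close>; \<open>z $ i\<close> is the position of vortex \<open>i\<close>.
\<close>

definition total_circulation :: "('n::finite \<Rightarrow> real) \<Rightarrow> real" where
  "total_circulation \<Gamma> = (\<Sum>i\<in>UNIV. \<Gamma> i)"

text \<open>Only meaningful when the total circulation is nonzero, as it is for positive circulations.\<close>

definition center_of_vorticity :: "('n::finite \<Rightarrow> real) \<Rightarrow> real ^ 2 ^ 'n \<Rightarrow> real ^ 2" where
  "center_of_vorticity \<Gamma> z = (1 / total_circulation \<Gamma>) *\<^sub>R (\<Sum>i\<in>UNIV. \<Gamma> i *\<^sub>R (z $ i))"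

definition angular_impulse :: "('n::finite \<Rightarrow> real) \<Rightarrow> real ^ 2 ^ 'n \<Rightarrow> real" where
  "angular_impulse \<Gamma> z = (\<Sum>i\<in>UNIV. \<Gamma> i * (norm (z $ i - center_of_vorticity \<Gamma> z))\<^sup>2)"

definition collision_set :: "(real ^ 2 ^ 'n::finite) set" where
  "collision_set = {z. \<exists>i j. i \<noteq> j \<and> z $ i = z $ j}"

definition normalized_space :: "('n::finite \<Rightarrow> real) \<Rightarrow> (real ^ 2 ^ 'n) set" where
  "normalized_space \<Gamma> = {z. center_of_vorticity \<Gamma> z = 0 \<and> angular_impulse \<Gamma> z = 1}"

definition relative_equilibrium :: "('n::finite \<Rightarrow> real) \<Rightarrow> real ^ 2 ^ 'n \<Rightarrow> bool" where
  "relative_equilibrium \<Gamma> z \<longleftrightarrow>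
     z \<notin> collision_set \<and>
     (\<exists>\<omega>::real. \<omega> \<noteq> 0 \<and>
       (\<forall>i. (\<Sum>j\<in>UNIV - {i}. (\<Gamma> i * \<Gamma> j / (norm (z $ i - z $ j))\<^sup>2) *\<^sub>R (z $ j - z $ i))
            + (\<omega> * \<Gamma> i) *\<^sub>R (z $ i - center_of_vorticity \<Gamma> z) = 0))"

end

theory Submission
  imports Defs
begin

text \<open>
  Taking the inner product of the \<open>i\<close>-th equation with \<open>z $ i\<close> and summing shows that on the
  normalized space the multiplier \<open>\<omega>\<close> equals the sum of \<open>\<Gamma> i * \<Gamma> j\<close> over all pairs. Suppose
  relative equilibria converge to a collision \<open>x\<close>, and let \<open>K\<close> be the cluster of vortices
  colliding at a point \<open>p\<close>. Taking the inner product with \<open>z $ i - p\<close> instead and summing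
  over \<open>K\<close> only, the interactions inside \<open>K\<close> contribute minus the sum of \<open>\<Gamma> i * \<Gamma> j\<close> over the pairs
  in \<open>K\<close>, a fixed negative number, whereas all other terms tend to zero, as \<open>\<omega>\<close> is constant
  and the distances from \<open>K\<close> to the other vortices stay away from zero.
\<close>

text \<open>Every unordered pair is counted twice, hence the factors 1/2 in the identities
  below.\<close>

definition ordered_pair_sum :: "('n::finite \<Rightarrow> real) \<Rightarrow> 'n set \<Rightarrow> real" where
  "ordered_pair_sum \<Gamma> K = (\<Sum>i\<in>K. \<Sum>j\<in>K - {i}. \<Gamma> i * \<Gamma> j)"

lemma ordered_pair_sum_pos:
  assumes "\<And>i. \<Gamma> i > 0" "a \<in> K" "b \<in> K" "a \<noteq> b"
  shows "ordered_pair_sum \<Gamma> K > 0"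
  unfolding ordered_pair_sum_def
proof (rule sum_pos2[of _ a])
  show "0 < (\<Sum>j\<in>K - {a}. \<Gamma> a * \<Gamma> j)"
    by (rule sum_pos2[of _ b]) (use assms in \<open>auto simp: less_imp_le\<close>)
  show "0 \<le> (\<Sum>j\<in>K - {i}. \<Gamma> i * \<Gamma> j)" for i
    by (intro sum_nonneg) (simp add: assms(1) less_imp_le)
qed (use assms in auto)

text \<open>Adding the terms for \<open>(i, j)\<close> and \<open>(j, i)\<close> cancels
  \<open>p\<close> and leaves minus the squared distance, which cancels the denominator.\<close>

lemma virial_identity:
  fixes z :: "'n::finite \<Rightarrow> 'a::real_inner"
  assumes "inj_on z K"
  shows "(\<Sum>i\<in>K. \<Sum>j\<in>K - {i}. \<Gamma> i * \<Gamma> j / (norm (z i - z j))\<^sup>2 * ((z j - z i) \<bullet> (z i - p)))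
    = - ordered_pair_sum \<Gamma> K / 2"
proof -
  define g where "g i j = \<Gamma> i * \<Gamma> j / (norm (z i - z j))\<^sup>2 * ((z j - z i) \<bullet> (z i - p))" for i j
  \<comment> \<open>Diagonal terms vanish because of the factor \<open>z i - z i\<close>; including
    them makes the index set a square, so that the two sums can be swapped.\<close>
  have g_diag: "(\<Sum>j\<in>K - {i}. g i j) = (\<Sum>j\<in>K. g i j)" for i
    by (rule sum.mono_neutral_left) (auto simp: g_def)
  have pair: "g i j + g j i = (if j = i then 0 else - (\<Gamma> i * \<Gamma> j))" if "i \<in> K" "j \<in> K" for i j
  proof (cases "j = i")
    case False
    then have "z i \<noteq> z j"
      using assms that by (auto dest: inj_onD)
    have "g i j + g j i = \<Gamma> i * \<Gamma> j / (norm (z i - z j))\<^sup>2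
        * ((z j - z i) \<bullet> (z i - p) + (z i - z j) \<bullet> (z j - p))"
      by (simp add: g_def norm_minus_commute[of "z j"] distrib_left mult.commute)
    also have "(z j - z i) \<bullet> (z i - p) + (z i - z j) \<bullet> (z j - p) = - (norm (z i - z j))\<^sup>2"
      by (simp add: power2_norm_eq_inner algebra_simps inner_commute)
    finally show ?thesis
      using \<open>z i \<noteq> z j\<close> False by simp
  qed (simp add: g_def)
  have "2 * (\<Sum>i\<in>K. \<Sum>j\<in>K. g i j) = (\<Sum>i\<in>K. \<Sum>j\<in>K. g i j) + (\<Sum>i\<in>K. \<Sum>j\<in>K. g j i)"
    by (subst (3) sum.swap) simp
  also have "\<dots> = (\<Sum>i\<in>K. \<Sum>j\<in>K. if j = i then 0 else - (\<Gamma> i * \<Gamma> j))"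
    by (simp add: sum.distrib[symmetric] pair)
  also have "\<dots> = (\<Sum>i\<in>K. \<Sum>j\<in>K - {i}. - (\<Gamma> i * \<Gamma> j))"
    by (intro sum.cong refl sum.mono_neutral_cong_right) auto
  finally show ?thesis
    unfolding g_def[symmetric] g_diag ordered_pair_sum_def by (simp add: sum_negf)
qed

lemma cluster_virial:
  fixes z :: "real ^ 2 ^ 'n::finite"
  assumes "z \<notin> collision_set"
    and eq: "\<And>i. (\<Sum>j\<in>UNIV - {i}. (\<Gamma> i * \<Gamma> j / (norm (z $ i - z $ j))\<^sup>2) *\<^sub>R (z $ j - z $ i))
            + (\<omega> * \<Gamma> i) *\<^sub>R (z $ i - c) = 0"
  shows "(\<Sum>i\<in>K. \<Sum>j\<in>- K. \<Gamma> i * \<Gamma> j / (norm (z $ i - z $ j))\<^sup>2 * ((z $ j - z $ i) \<bullet> (z $ i - p)))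
    + \<omega> * (\<Sum>i\<in>K. \<Gamma> i * ((z $ i - c) \<bullet> (z $ i - p))) = ordered_pair_sum \<Gamma> K / 2"
proof -
  define g where "g i j = \<Gamma> i * \<Gamma> j / (norm (z $ i - z $ j))\<^sup>2 * ((z $ j - z $ i) \<bullet> (z $ i - p))"
    for i j
  have split: "(\<Sum>j\<in>UNIV - {i}. g i j) = (\<Sum>j\<in>K - {i}. g i j) + (\<Sum>j\<in>- K. g i j)"
    if "i \<in> K" for i
  proof -
    have "UNIV - {i} = (K - {i}) \<union> - K"
      using that by auto
    then show ?thesis
      by (simp add: sum.union_disjoint disjoint_iff)
  qed
  have "(\<Sum>j\<in>UNIV - {i}. g i j) + \<omega> * (\<Gamma> i * ((z $ i - c) \<bullet> (z $ i - p))) = 0" for i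
    using arg_cong[OF eq[of i], of "\<lambda>v. v \<bullet> (z $ i - p)"]
    by (simp add: g_def inner_add_left inner_sum_left mult.assoc)
  then have "(\<Sum>i\<in>K. (\<Sum>j\<in>UNIV - {i}. g i j) + \<omega> * (\<Gamma> i * ((z $ i - c) \<bullet> (z $ i - p)))) = 0"
    by simp
  then have "(\<Sum>i\<in>K. \<Sum>j\<in>K - {i}. g i j) + (\<Sum>i\<in>K. \<Sum>j\<in>- K. g i j)
      + \<omega> * (\<Sum>i\<in>K. \<Gamma> i * ((z $ i - c) \<bullet> (z $ i - p))) = 0"
    by (simp add: split sum.distrib sum_distrib_left)
  moreover have "inj_on (($) z) K"
    using assms(1) by (auto simp: collision_set_def inj_on_def)
  then have "(\<Sum>i\<in>K. \<Sum>j\<in>K - {i}. g i j) = - ordered_pair_sum \<Gamma> K / 2"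
    unfolding g_def by (rule virial_identity)
  ultimately show ?thesis
    by (simp add: g_def)
qed

text \<open>Eliminates the multiplier, which could otherwise vary along a sequence of relative
  equilibria.\<close>

lemma normalized_relative_equilibrium_virial:
  fixes z :: "real ^ 2 ^ 'n::finite"
  assumes "z \<in> normalized_space \<Gamma>" "relative_equilibrium \<Gamma> z"
  shows "(\<Sum>i\<in>K. \<Sum>j\<in>- K. \<Gamma> i * \<Gamma> j / (norm (z $ i - z $ j))\<^sup>2 * ((z $ j - z $ i) \<bullet> (z $ i - p)))
    + ordered_pair_sum \<Gamma> UNIV / 2 * (\<Sum>i\<in>K. \<Gamma> i * (z $ i \<bullet> (z $ i - p)))
    = ordered_pair_sum \<Gamma> K / 2"
proof -
  have c: "center_of_vorticity \<Gamma> z = 0" and I: "(\<Sum>i\<in>UNIV. \<Gamma> i * (z $ i \<bullet> z $ i)) = 1"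
    using assms(1)
    by (auto simp: normalized_space_def angular_impulse_def power2_norm_eq_inner)
  obtain \<omega> where nc: "z \<notin> collision_set"
    and eq: "\<And>i. (\<Sum>j\<in>UNIV - {i}. (\<Gamma> i * \<Gamma> j / (norm (z $ i - z $ j))\<^sup>2) *\<^sub>R (z $ j - z $ i))
            + (\<omega> * \<Gamma> i) *\<^sub>R (z $ i - 0) = 0"
    using assms(2) unfolding relative_equilibrium_def c by blast
  \<comment> \<open>For \<open>K = UNIV\<close> there are no outer terms, and with
    \<open>p = 0\<close> the factor of \<omega> is the angular impulse, equal to 1.\<close>
  have omega: "\<omega> = ordered_pair_sum \<Gamma> UNIV / 2"
    using cluster_virial[OF nc eq, where K = UNIV and p = 0] I by simp
  show ?thesis
    using cluster_virial[OF nc eq, where K = K and p = p] unfolding omega diff_zero .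
qed

lemma collision_notin_closure:
  fixes x :: "real ^ 2 ^ 'n::finite"
  assumes "\<And>i. \<Gamma> i > 0" "x \<in> collision_set"
  shows "x \<notin> closure {z \<in> normalized_space \<Gamma>. relative_equilibrium \<Gamma> z}"
proof
  assume "x \<in> closure {z \<in> normalized_space \<Gamma>. relative_equilibrium \<Gamma> z}"
  then obtain f where f: "\<And>n. f n \<in> normalized_space \<Gamma>" "\<And>n. relative_equilibrium \<Gamma> (f n)"
    and lim: "f \<longlonglongrightarrow> x"
    by (auto simp: closure_sequential)
  obtain a b where ab: "a \<noteq> b" "x $ a = x $ b"
    using assms(2) by (auto simp: collision_set_def)
  \<comment> \<open>The whole cluster is taken, not just \<open>a\<close> and \<open>b\<close>, so
    that the denominators in \<open>F\<close> stay nonzero at \<open>x\<close>.\<close>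
  define K where "K = {k. x $ k = x $ a}"
  define F where "F z = (\<Sum>i\<in>K. \<Sum>j\<in>- K.
      \<Gamma> i * \<Gamma> j / (norm (z $ i - z $ j))\<^sup>2 * ((z $ j - z $ i) \<bullet> (z $ i - x $ a)))
    + ordered_pair_sum \<Gamma> UNIV / 2 * (\<Sum>i\<in>K. \<Gamma> i * (z $ i \<bullet> (z $ i - x $ a)))"
    for z :: "real ^ 2 ^ 'n"
  have "(\<lambda>n. F (f n)) \<longlonglongrightarrow> F x"
    unfolding F_def by (intro tendsto_intros lim) (auto simp: K_def)
  \<comment> \<open>Each summand contains the factor \<open>x $ i - x $ a\<close>, which is zero for
    \<open>i\<close> in \<open>K\<close>.\<close>
  moreover have "F x = 0"
    unfolding F_def by (simp add: K_def)
  moreover have "F (f n) = ordered_pair_sum \<Gamma> K / 2" for n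
    unfolding F_def by (rule normalized_relative_equilibrium_virial[OF f])
  ultimately have "ordered_pair_sum \<Gamma> K = 0"
    by (simp add: LIMSEQ_const_iff)
  moreover have "ordered_pair_sum \<Gamma> K > 0"
    by (rule ordered_pair_sum_pos[of _ a _ b]) (use assms(1) ab in \<open>auto simp: K_def\<close>)
  ultimately show False
    by simp
qed

theorem theorem2p5:
  fixes \<Gamma> :: "'n::finite \<Rightarrow> real"
  assumes "\<And>i. \<Gamma> i > 0"
  shows "\<exists>U. openin (top_of_set (normalized_space \<Gamma>)) U \<and>
             collision_set \<inter> normalized_space \<Gamma> \<subseteq> U \<and>
             (\<forall>z\<in>U. \<not> relative_equilibrium \<Gamma> z)"
proof -
  let ?S = "{z \<in> normalized_space \<Gamma>. relative_equilibrium \<Gamma> z}"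
  \<comment> \<open>This is the largest relatively open set free of relative equilibria.\<close>
  let ?U = "normalized_space \<Gamma> \<inter> - closure ?S"
  have "openin (top_of_set (normalized_space \<Gamma>)) ?U"
    by (intro openin_open_Int) auto
  moreover have "collision_set \<inter> normalized_space \<Gamma> \<subseteq> ?U"
    using collision_notin_closure[of \<Gamma>] assms by blast
  moreover have "\<forall>z\<in>?U. \<not> relative_equilibrium \<Gamma> z"
    using closure_subset[of ?S] by blast
  ultimately show ?thesis
    by blast
qed

end
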